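(* Let $S$ be a regular monoid such that for every finitely generated right congruence $\rho$ on $S$ and every $a,b,x,y\in S$ the right ideals $(aS)\rho\cap(bS)\rho$ and $(aS,x)\cap(bS,y)$ are finitely generated. Then $S$ is right coherent.
   Context: A monoid $S$ is regular if for every $a\in S$ there is $b\in S$ with $a=aba$. A right ideal of $S$ is a subset $I$ with $IS\subseteq I$; the empty set is allowed as a right ideal, and it is regarded as finitely generated. A right ideal $I$ is finitely generated if $I=a_1S\cup\dots\cup a_nS$ for some finite (possibly empty) list $a_1,\dots,a_n\in I$. A right congruence on $S$ is an equivalence relation $\rho$ with $a\,\rho\,b\Rightarrow ac\,\rho\,bc$ for all $a,b,c\in S$; it is finitely generated if it is the smallest right congruence containing some finite subset of $S\times S$. For a right ideal $I$ of $S$, a right congruence $\rho$ and $x\in S$, write $I\rho=\{s\in S: s\,\rho\,a \text{ for some } a\in I\}$ and $(I,x)=\{t\in S: xt\in I\}$; both are right ideals of $S$. A right $S$-act is a set $A$ with a map $A\times S\to A$, $(a,s)\mapsto as$, with $a1=a$ and $a(st)=(as)t$. The free right $S$-act on a set $X$ is $F_S(X)=X\times S$ with $(x,s)t=(x,st)$. A congruence on a right $S$-act is an equivalence relation preserved by the action; it is finitely generated if it is the smallest congruence containing some finite set of pairs. An act $A$ is finitely generated if $A=a_1S\cup\dots\cup a_nS$ for some $a_i\in A$, and finitely presented if it is isomorphic to $F_S(X)/\rho$ with $X$ finite and $\rho$ a finitely generated congruence. The empty set is allowed as a subact (and is finitely generated). The monoid $S$ is right coherent if every finitely generated subact of every finitely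 presented right $S$-act is finitely presented. *)

theory Defs
  imports Main
begin

text \<open>
  The monoid \<open>S\<close> is the whole of a type \<open>'s\<close> of class \<^class>\<open>monoid_mult\<close>. A right \<open>S\<close>-act is
  given by a carrier set and an action, which is only constrained on the carrier; the carrier
  may be empty.
\<close>

definition regular_monoid :: "'s::monoid_mult itself \<Rightarrow> bool" where
  "regular_monoid _ \<longleftrightarrow> (\<forall>a::'s. \<exists>b. a = a * b * a)"

subsection \<open>Right ideals and right congruences\<close>

definition right_ideal :: "'s::monoid_mult set \<Rightarrow> bool" where
  "right_ideal I \<longleftrightarrow> (\<forall>a\<in>I. \<forall>s. a * s \<in> I)"

definition principal_right_ideal :: "'s::monoid_mult \<Rightarrow> 's set" where
  "principal_right_ideal a = {a * s | s. True}"

definition fg_right_ideal :: "'s::monoid_mult set \<Rightarrow> bool" where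
  "fg_right_ideal I \<longleftrightarrow> right_ideal I \<and>
     (\<exists>F. finite F \<and> F \<subseteq> I \<and> I = (\<Union>a\<in>F. principal_right_ideal a))"

definition right_congruence :: "('s::monoid_mult \<times> 's) set \<Rightarrow> bool" where
  "right_congruence \<rho> \<longleftrightarrow> equiv UNIV \<rho> \<and> (\<forall>a b c. (a, b) \<in> \<rho> \<longrightarrow> (a * c, b * c) \<in> \<rho>)"

definition fg_right_congruence :: "('s::monoid_mult \<times> 's) set \<Rightarrow> bool" where
  "fg_right_congruence \<rho> \<longleftrightarrow> right_congruence \<rho> \<and>
     (\<exists>H. finite H \<and> H \<subseteq> \<rho> \<and> (\<forall>\<sigma>. right_congruence \<sigma> \<and> H \<subseteq> \<sigma> \<longrightarrow> \<rho> \<subseteq> \<sigma>))"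

text \<open>\<open>saturation I \<rho>\<close> is \<open>I\<rho>\<close> and \<open>residual I x\<close> is \<open>(I, x)\<close>.\<close>

definition saturation :: "'s::monoid_mult set \<Rightarrow> ('s \<times> 's) set \<Rightarrow> 's set" where
  "saturation I \<rho> = {s. \<exists>a\<in>I. (s, a) \<in> \<rho>}"

definition residual :: "'s::monoid_mult set \<Rightarrow> 's \<Rightarrow> 's set" where
  "residual I x = {t. x * t \<in> I}"

subsection \<open>Right acts\<close>

definition right_act :: "'b set \<Rightarrow> ('b \<Rightarrow> 's::monoid_mult \<Rightarrow> 'b) \<Rightarrow> bool" where
  "right_act A act \<longleftrightarrow> (\<forall>a\<in>A. \<forall>s. act a s \<in> A) \<and> (\<forall>a\<in>A. act a 1 = a) \<and>
     (\<forall>a\<in>A. \<forall>s t. act a (s * t) = act (act a s) t)"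

definition subact :: "'b set \<Rightarrow> 'b set \<Rightarrow> ('b \<Rightarrow> 's::monoid_mult \<Rightarrow> 'b) \<Rightarrow> bool" where
  "subact B A act \<longleftrightarrow> B \<subseteq> A \<and> (\<forall>b\<in>B. \<forall>s. act b s \<in> B)"

definition fg_act :: "'b set \<Rightarrow> ('b \<Rightarrow> 's::monoid_mult \<Rightarrow> 'b) \<Rightarrow> bool" where
  "fg_act A act \<longleftrightarrow> right_act A act \<and>
     (\<exists>F. finite F \<and> F \<subseteq> A \<and> A = (\<Union>a\<in>F. {act a s | s. True}))"

definition act_congruence ::
    "'b set \<Rightarrow> ('b \<Rightarrow> 's::monoid_mult \<Rightarrow> 'b) \<Rightarrow> ('b \<times> 'b) set \<Rightarrow> bool" where
  "act_congruence A act \<rho> \<longleftrightarrow>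
     equiv A \<rho> \<and> (\<forall>a b s. (a, b) \<in> \<rho> \<longrightarrow> (act a s, act b s) \<in> \<rho>)"

definition fg_act_congruence ::
    "'b set \<Rightarrow> ('b \<Rightarrow> 's::monoid_mult \<Rightarrow> 'b) \<Rightarrow> ('b \<times> 'b) set \<Rightarrow> bool" where
  "fg_act_congruence A act \<rho> \<longleftrightarrow> act_congruence A act \<rho> \<and>
     (\<exists>H. finite H \<and> H \<subseteq> \<rho> \<and> (\<forall>\<sigma>. act_congruence A act \<sigma> \<and> H \<subseteq> \<sigma> \<longrightarrow> \<rho> \<subseteq> \<sigma>))"

definition free_act_carrier :: "'x set \<Rightarrow> ('x \<times> 's::monoid_mult) set" where
  "free_act_carrier X = X \<times> UNIV"

definition free_action :: "'x \<times> 's::monoid_mult \<Rightarrow> 's \<Rightarrow> 'x \<times> 's" where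
  "free_action p t = (fst p, snd p * t)"

text \<open>
  The action on congruence classes, \<open>[a] s = [a s]\<close>, the union ranging over all representatives
  of the class; see \<open>quotient_action_class\<close>.
\<close>

definition quotient_action ::
    "('b \<Rightarrow> 's::monoid_mult \<Rightarrow> 'b) \<Rightarrow> ('b \<times> 'b) set \<Rightarrow> 'b set \<Rightarrow> 's \<Rightarrow> 'b set" where
  "quotient_action act \<rho> C s = (\<Union>a\<in>C. \<rho> `` {act a s})"

lemma quotient_action_class:
  assumes "act_congruence A act \<rho>" and "a \<in> A"
  shows "quotient_action act \<rho> (\<rho> `` {a}) s = \<rho> `` {act a s}"
proof -
  have eq: "equiv A \<rho>" and cong: "\<And>a b s. (a, b) \<in> \<rho> \<Longrightarrow> (act a s, act b s) \<in> \<rho>"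
    using assms(1) unfolding act_congruence_def by blast+
  have "\<rho> `` {act b s} = \<rho> `` {act a s}" if "b \<in> \<rho> `` {a}" for b
    using that equiv_class_eq[OF eq cong, of a b s] by simp
  moreover have "a \<in> \<rho> `` {a}"
    using equiv_class_self[OF eq assms(2)] .
  ultimately show ?thesis
    unfolding quotient_action_def by blast
qed

definition act_iso ::
    "('b \<Rightarrow> 'c) \<Rightarrow> 'b set \<Rightarrow> ('b \<Rightarrow> 's::monoid_mult \<Rightarrow> 'b) \<Rightarrow> 'c set \<Rightarrow> ('c \<Rightarrow> 's \<Rightarrow> 'c) \<Rightarrow> bool" where
  "act_iso f A act B act' \<longleftrightarrow>
     bij_betw f A B \<and> (\<forall>a\<in>A. \<forall>s. f (act a s) = act' (f a) s)"

text \<open>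
  The finite set of free generators is taken to be a set of natural numbers; up to isomorphism
  of free acts this is no restriction.
\<close>

definition fp_act :: "'b set \<Rightarrow> ('b \<Rightarrow> 's::monoid_mult \<Rightarrow> 'b) \<Rightarrow> bool" where
  "fp_act A act \<longleftrightarrow> right_act A act \<and>
     (\<exists>(X :: nat set) (\<rho> :: ((nat \<times> 's) \<times> (nat \<times> 's)) set) f.
        finite X \<and> fg_act_congruence (free_act_carrier X) free_action \<rho> \<and>
        act_iso f A act (free_act_carrier X // \<rho>) (quotient_action free_action \<rho>))"

text \<open>
  HOL has no quantification over types inside a formula, so the type \<open>'b\<close> in which the carriers
  of the acts live is a parameter. Right coherence of \<open>S\<close> is \<open>right_coherent TYPE('s) TYPE('b)\<close>
  for arbitrary \<open>'b\<close>, that is, with \<open>'b\<close> a free type variable of a theorem's conclusion.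
\<close>

definition right_coherent :: "'s::monoid_mult itself \<Rightarrow> 'b itself \<Rightarrow> bool" where
  "right_coherent _ _ \<longleftrightarrow>
     (\<forall>(A :: 'b set) (act :: 'b \<Rightarrow> 's \<Rightarrow> 'b) B.
        fp_act A act \<and> subact B A act \<and> fg_act B act \<longrightarrow> fp_act B act)"

end

theory Submission
  imports Defs
begin

text \<open>
  Let \<open>A = F(X)/\<rho>\<close> be finitely presented, \<open>B\<close> a finitely generated subact and \<open>J\<close> its preimage in
  \<open>F(X)\<close>. If \<open>J\<close> is finitely generated, then \<open>J\<close> is finitely presented, because principal right
  ideals of a regular monoid are generated by idempotents and two of them meet in a finitely
  generated right ideal. The restriction of \<open>\<rho>\<close> to \<open>J\<close> is finitely generated: as \<open>J\<close> is
  \<open>\<rho>\<close>-saturated, a generating pair \<open>(p, q)\<close> acts on \<open>J\<close> only through the \<open>t\<close> with \<open>pt \<in> J\<close>, and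
  these form a finitely generated right ideal. Hence \<open>B \<cong> J/\<rho>\<close> is finitely presented.

  So it suffices that \<open>\<rho>\<close>-saturations of cyclic subacts \<open>(j, a)S\<close> of \<open>F(X)\<close> are finitely generated,
  which is proved by induction on \<open>X\<close>. For a free generator \<open>l \<noteq> j\<close>, the part of a saturated subact
  over \<open>l\<close> is the saturation, under the congruence on \<open>S\<close> generated by the pairs of \<open>\<rho>\<close> lying over
  \<open>l\<close>, of the elements entering from the other components through one of the finitely many
  remaining pairs; so it is finitely generated once the other components are. Applied to the
  saturation of \<open>F(X - {l})\<close>, this and the argument above show that the restriction of \<open>\<rho>\<close> to
  \<open>F(X - {l})\<close> is finitely generated, and the induction proceeds.
\<close>

section \<open>Finitely generated right ideals\<close>

lemma mem_principal_right_ideal: "s \<in> principal_right_ideal a \<longleftrightarrow> (\<exists>t. s = a * t)"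
  by (auto simp: principal_right_ideal_def)

lemma self_mem_principal_right_ideal: "a \<in> principal_right_ideal (a :: 's::monoid_mult)"
  unfolding mem_principal_right_ideal by (metis mult_1_right)

lemma fg_right_ideal_iff:
  "fg_right_ideal I \<longleftrightarrow> (\<exists>F. finite F \<and> I = (\<Union>a\<in>F. principal_right_ideal (a :: 's::monoid_mult)))"
proof
  assume "\<exists>F. finite F \<and> I = (\<Union>a\<in>F. principal_right_ideal a)"
  then obtain F where F: "finite F" "I = (\<Union>a\<in>F. principal_right_ideal a)" by blast
  have "right_ideal I"
    unfolding right_ideal_def F(2) principal_right_ideal_def by (clarsimp simp: mult.assoc) blast
  moreover have "F \<subseteq> I"
    unfolding F(2) using self_mem_principal_right_ideal by blast
  ultimately show "fg_right_ideal I"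
    unfolding fg_right_ideal_def using F by blast
qed (auto simp: fg_right_ideal_def)

lemma fg_right_ideal_principal: "fg_right_ideal (principal_right_ideal a)"
  unfolding fg_right_ideal_iff by (rule exI[of _ "{a}"]) simp

lemma fg_right_ideal_empty: "fg_right_ideal {}"
  unfolding fg_right_ideal_iff by (rule exI[of _ "{}"]) simp

lemma fg_right_ideal_UNIV: "fg_right_ideal UNIV"
proof -
  have "(UNIV :: 's::monoid_mult set) = principal_right_ideal 1"
    by (auto simp: mem_principal_right_ideal)
  then show ?thesis
    using fg_right_ideal_principal by metis
qed

lemma fg_right_ideal_UN:
  assumes "finite K" and "\<And>k. k \<in> K \<Longrightarrow> fg_right_ideal (I k)"
  shows "fg_right_ideal (\<Union>k\<in>K. I k)"
proof -
  have "\<forall>k\<in>K. \<exists>F. finite F \<and> I k = (\<Union>a\<in>F. principal_right_ideal a)"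
    using assms(2) fg_right_ideal_iff by blast
  then obtain F where F: "\<forall>k\<in>K. finite (F k) \<and> I k = (\<Union>a\<in>F k. principal_right_ideal a)"
    using bchoice[of K "\<lambda>k F. finite F \<and> I k = (\<Union>a\<in>F. principal_right_ideal a)"] by blast
  then have "(\<Union>k\<in>K. I k) = (\<Union>a\<in>(\<Union>k\<in>K. F k). principal_right_ideal a)"
    by auto
  moreover have "finite (\<Union>k\<in>K. F k)"
    using F assms(1) by blast
  ultimately show ?thesis
    unfolding fg_right_ideal_iff by blast
qed

lemma fg_right_ideal_Un: "fg_right_ideal I \<Longrightarrow> fg_right_ideal I' \<Longrightarrow> fg_right_ideal (I \<union> I')"
  using fg_right_ideal_UN[of "{True, False}" "\<lambda>b. if b then I else I'"] by (simp add: Un_commute)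

lemma fg_right_ideal_image_mult:
  assumes "fg_right_ideal I"
  shows "fg_right_ideal ((*) c ` I)"
proof -
  obtain F where F: "finite F" "I = (\<Union>a\<in>F. principal_right_ideal a)"
    using assms fg_right_ideal_iff by blast
  have "(*) c ` I = (\<Union>a\<in>(*) c ` F. principal_right_ideal a)"
    unfolding F(2) by (auto simp: principal_right_ideal_def image_iff mult.assoc)
  then show ?thesis
    unfolding fg_right_ideal_iff using F(1) by blast
qed

section \<open>Congruences on acts\<close>

lemma free_action_Pair: "free_action (x, s) t = (x, s * t)"
  by (simp add: free_action_def)

lemma fst_free_action: "fst (free_action p s) = fst p"
  by (simp add: free_action_def)

lemma snd_free_action: "snd (free_action p s) = snd p * s"
  by (simp add: free_action_def)

lemma free_action_1: "free_action p 1 = p"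
  by (simp add: free_action_def)

lemma free_action_mult: "free_action p (s * t) = free_action (free_action p s) t"
  by (simp add: free_action_def mult.assoc)

lemma mem_free_act_carrier: "p \<in> free_act_carrier X \<longleftrightarrow> fst p \<in> X"
  by (auto simp: free_act_carrier_def mem_Times_iff)

lemmas free_act_simps = free_action_Pair fst_free_action free_action_1 mem_free_act_carrier

lemma right_act_free: "right_act (free_act_carrier X) free_action"
  by (simp add: right_act_def free_act_simps free_action_mult)

lemma right_act_regular: "right_act (UNIV :: 's::monoid_mult set) (*)"
  by (simp add: right_act_def mult.assoc)

lemma right_congruence_iff: "right_congruence \<rho> \<longleftrightarrow> act_congruence UNIV (*) \<rho>"
  by (simp add: right_congruence_def act_congruence_def)

lemma fg_right_congruence_iff: "fg_right_congruence \<rho> \<longleftrightarrow> fg_act_congruence UNIV (*) \<rho>"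
  by (simp add: fg_right_congruence_def fg_act_congruence_def right_congruence_iff)

lemma act_congruenceI:
  assumes "\<rho> \<subseteq> A \<times> A" and "\<And>a. a \<in> A \<Longrightarrow> (a, a) \<in> \<rho>" and "\<And>a b. (a, b) \<in> \<rho> \<Longrightarrow> (b, a) \<in> \<rho>"
    and "\<And>a b c. (a, b) \<in> \<rho> \<Longrightarrow> (b, c) \<in> \<rho> \<Longrightarrow> (a, c) \<in> \<rho>"
    and "\<And>a b s. (a, b) \<in> \<rho> \<Longrightarrow> (act a s, act b s) \<in> \<rho>"
  shows "act_congruence A act \<rho>"
  unfolding act_congruence_def
  by (intro conjI equivI refl_onI symI transI allI impI) (fact assms)+

lemma act_congruenceD:
  assumes "act_congruence A act \<rho>"
  shows "(a, b) \<in> \<rho> \<Longrightarrow> a \<in> A" and "(a, b) \<in> \<rho> \<Longrightarrow> b \<in> A"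
    and "a \<in> A \<Longrightarrow> (a, a) \<in> \<rho>" and "(a, b) \<in> \<rho> \<Longrightarrow> (b, a) \<in> \<rho>"
    and "(a, b) \<in> \<rho> \<Longrightarrow> (b, c) \<in> \<rho> \<Longrightarrow> (a, c) \<in> \<rho>"
    and "(a, b) \<in> \<rho> \<Longrightarrow> (act a s, act b s) \<in> \<rho>"
proof -
  have eq: "equiv A \<rho>" and act: "\<forall>a b s. (a, b) \<in> \<rho> \<longrightarrow> (act a s, act b s) \<in> \<rho>"
    using assms by (simp_all add: act_congruence_def)
  from eq have sub: "\<rho> \<subseteq> A \<times> A" and R: "refl_on A \<rho>" "sym \<rho>" "trans \<rho>"
    by (simp_all add: equiv_def)
  show "(a, b) \<in> \<rho> \<Longrightarrow> a \<in> A" "(a, b) \<in> \<rho> \<Longrightarrow> b \<in> A"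
    using sub by blast+
  show "a \<in> A \<Longrightarrow> (a, a) \<in> \<rho>" "(a, b) \<in> \<rho> \<Longrightarrow> (b, a) \<in> \<rho>"
    by (rule refl_onD[OF R(1)] symD[OF R(2)]; assumption)+
  show "(a, b) \<in> \<rho> \<Longrightarrow> (b, c) \<in> \<rho> \<Longrightarrow> (a, c) \<in> \<rho>"
    by (rule transD[OF R(3)])
  show "(a, b) \<in> \<rho> \<Longrightarrow> (act a s, act b s) \<in> \<rho>"
    using act by simp
qed

section \<open>Congruences generated by a set of pairs\<close>

text \<open>The rule \<open>base\<close> admits only pairs within \<open>A\<close>, so that the
  result is a congruence on \<open>A\<close> for every relation \<open>G\<close>.\<close>

inductive_set generated_congruence ::
    "'b set \<Rightarrow> ('b \<Rightarrow> 's::monoid_mult \<Rightarrow> 'b) \<Rightarrow> ('b \<times> 'b) set \<Rightarrow> ('b \<times> 'b) set"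
  for A act G where
    base: "(a, b) \<in> G \<Longrightarrow> a \<in> A \<Longrightarrow> b \<in> A \<Longrightarrow> (a, b) \<in> generated_congruence A act G"
  | refl: "a \<in> A \<Longrightarrow> (a, a) \<in> generated_congruence A act G"
  | sym: "(a, b) \<in> generated_congruence A act G \<Longrightarrow> (b, a) \<in> generated_congruence A act G"
  | trans: "(a, b) \<in> generated_congruence A act G \<Longrightarrow> (b, c) \<in> generated_congruence A act G
      \<Longrightarrow> (a, c) \<in> generated_congruence A act G"
  | act: "(a, b) \<in> generated_congruence A act G
      \<Longrightarrow> (act a s, act b s) \<in> generated_congruence A act G"

lemma act_congruence_generated:
  assumes "right_act A act"
  shows "act_congruence A act (generated_congruence A act G)"
proof (rule act_congruenceI)
  have "a \<in> A \<and> b \<in> A" if "(a, b) \<in> generated_congruence A act G" for a b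
    using that by induction (use assms in \<open>auto simp: right_act_def\<close>)
  then show "generated_congruence A act G \<subseteq> A \<times> A"
    by auto
qed (fact generated_congruence.intros)+

lemma generated_congruence_subset:
  assumes "act_congruence A act \<sigma>" and "G \<subseteq> \<sigma>"
  shows "generated_congruence A act G \<subseteq> \<sigma>"
proof -
  have "(a, b) \<in> \<sigma>" if "(a, b) \<in> generated_congruence A act G" for a b
    using that
  proof induction
    case (base a b)
    then show ?case
      using assms(2) by blast
  qed (rule act_congruenceD[OF assms(1)]; assumption)+
  then show ?thesis
    by auto
qed

lemma subset_generated_congruence: "G \<subseteq> A \<times> A \<Longrightarrow> G \<subseteq> generated_congruence A act G"
  by (auto intro: generated_congruence.base)

lemma fg_act_congruence_generated:
  assumes "right_act A act" and "finite G" and "G \<subseteq> A \<times> A"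
  shows "fg_act_congruence A act (generated_congruence A act G)"
  unfolding fg_act_congruence_def
  by (intro conjI exI[of _ G] allI impI act_congruence_generated assms
      subset_generated_congruence) (auto dest: generated_congruence_subset)

lemma fg_act_congruenceI:
  assumes "act_congruence A act \<rho>" and "finite G" and "G \<subseteq> \<rho>"
    and "\<rho> \<subseteq> generated_congruence A act G"
  shows "fg_act_congruence A act \<rho>"
  unfolding fg_act_congruence_def
proof (intro conjI exI[of _ G] allI impI assms)
  fix \<sigma> assume "act_congruence A act \<sigma> \<and> G \<subseteq> \<sigma>"
  then have "generated_congruence A act G \<subseteq> \<sigma>"
    by (simp add: generated_congruence_subset)
  with assms(4) show "\<rho> \<subseteq> \<sigma>"
    by (rule subset_trans)
qed

lemma fg_act_congruenceE:
  assumes "fg_act_congruence A act \<rho>"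
  obtains H where "act_congruence A act \<rho>" "finite H" "H \<subseteq> \<rho>"
    "\<And>\<sigma>. act_congruence A act \<sigma> \<Longrightarrow> H \<subseteq> \<sigma> \<Longrightarrow> \<rho> \<subseteq> \<sigma>"
proof -
  from assms obtain H where "act_congruence A act \<rho>" "finite H" "H \<subseteq> \<rho>"
    and min: "\<forall>\<sigma>. act_congruence A act \<sigma> \<and> H \<subseteq> \<sigma> \<longrightarrow> \<rho> \<subseteq> \<sigma>"
    unfolding fg_act_congruence_def by (elim conjE exE)
  then show thesis
    by (intro that[of H]) simp_all
qed

text \<open>Stated with the filter of finite subsets of \<open>\<rho>\<close> so that finitely many
  demands on a generating set can later be combined without listing the pairs; here every
  \<open>G\<close> containing \<open>(a, b)\<close> will do.\<close>

lemma eventually_mem_generated_congruence: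
  assumes "act_congruence A act \<rho>" and "(a, b) \<in> \<rho>"
  shows "\<forall>\<^sub>F G in finite_subsets_at_top \<rho>. (a, b) \<in> generated_congruence A act G"
  unfolding eventually_finite_subsets_at_top
  by (rule exI[of _ "{(a, b)}"])
    (use assms act_congruenceD(1,2)[OF assms] in \<open>auto intro: generated_congruence.base\<close>)

section \<open>Subacts of free acts\<close>

text \<open>Subacts of a free act are handled one component at a time: for finite \<open>X\<close>,
  a subact of F(X) is finitely generated exactly if all its fibres are finitely generated right
  ideals.\<close>

definition fibre :: "('x \<times> 's) set \<Rightarrow> 'x \<Rightarrow> 's set" where
  "fibre M x = {s. (x, s) \<in> M}"

text \<open>The kernel of the composite F(Y) \<rightarrow> F(X) \<rightarrow> F(X)/\<rho> that sends
  the free generator \<open>y\<close> to the class of \<open>g y\<close>.\<close>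

definition pullback ::
    "'y set \<Rightarrow> ('y \<Rightarrow> 'x \<times> 's::monoid_mult) \<Rightarrow> (('x \<times> 's) \<times> ('x \<times> 's)) set
      \<Rightarrow> (('y \<times> 's) \<times> ('y \<times> 's)) set" where
  "pullback Y g \<rho> = {(v, w). v \<in> free_act_carrier Y \<and> w \<in> free_act_carrier Y \<and>
     (free_action (g (fst v)) (snd v), free_action (g (fst w)) (snd w)) \<in> \<rho>}"

lemma act_congruence_pullback:
  assumes \<rho>: "act_congruence (free_act_carrier X) free_action \<rho>"
    and g: "\<And>y. y \<in> Y \<Longrightarrow> g y \<in> free_act_carrier X"
  shows "act_congruence (free_act_carrier Y) free_action (pullback Y g \<rho>)"
proof -
  note D = act_congruenceD[OF \<rho>]
  show ?thesis
  proof (rule act_congruenceI)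
    fix u v w s
    show "u \<in> free_act_carrier Y \<Longrightarrow> (u, u) \<in> pullback Y g \<rho>"
      using g by (simp add: pullback_def free_act_simps D(3))
    show "(u, v) \<in> pullback Y g \<rho> \<Longrightarrow> (v, u) \<in> pullback Y g \<rho>"
      by (simp add: pullback_def D(4))
    show "(u, v) \<in> pullback Y g \<rho> \<Longrightarrow> (v, w) \<in> pullback Y g \<rho> \<Longrightarrow> (u, w) \<in> pullback Y g \<rho>"
      using D(5) unfolding pullback_def by blast
    show "(u, v) \<in> pullback Y g \<rho> \<Longrightarrow> (free_action u s, free_action v s) \<in> pullback Y g \<rho>"
      using D(6)[of "free_action (g (fst u)) (snd u)" "free_action (g (fst v)) (snd v)" s]
      by (simp add: pullback_def free_act_simps snd_free_action free_action_mult)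
  qed (auto simp: pullback_def)
qed

section \<open>Saturations and restrictions of congruences\<close>

text \<open>The instances of the theorem's hypotheses on which the argument runs: equal ideals give
  single saturations and single residuals, and residuals by 1 give intersections of principal right
  ideals.\<close>

locale ideal_coherent =
  fixes S :: "'s::monoid_mult itself"
  assumes regular: "\<exists>b. (a :: 's) = a * b * a"
    and fg_saturation_principal: "fg_right_congruence (\<rho> :: ('s \<times> 's) set) \<Longrightarrow>
      fg_right_ideal (saturation (principal_right_ideal a) \<rho>)"
    and fg_inter_principal:
      "fg_right_ideal (principal_right_ideal (a :: 's) \<inter> principal_right_ideal b)"
    and fg_residual_principal: "fg_right_ideal (residual (principal_right_ideal (a :: 's)) x)"
begin

lemma fg_residual:
  assumes "fg_right_ideal (I :: 's set)"
  shows "fg_right_ideal (residual I x)"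
proof -
  obtain F where F: "finite F" "I = (\<Union>a\<in>F. principal_right_ideal a)"
    using assms fg_right_ideal_iff by blast
  have "residual I x = (\<Union>a\<in>F. residual (principal_right_ideal a) x)"
    by (auto simp: F(2) residual_def)
  then show ?thesis
    using fg_right_ideal_UN[OF F(1)] fg_residual_principal by metis
qed

lemma fg_saturation:
  assumes "fg_right_ideal (I :: 's set)" and "fg_right_congruence \<rho>"
  shows "fg_right_ideal (saturation I \<rho>)"
proof -
  obtain F where F: "finite F" "I = (\<Union>a\<in>F. principal_right_ideal a)"
    using assms(1) fg_right_ideal_iff by blast
  have "saturation I \<rho> = (\<Union>a\<in>F. saturation (principal_right_ideal a) \<rho>)"
    by (auto simp: F(2) saturation_def)
  then show ?thesis
    using fg_right_ideal_UN[OF F(1)] fg_saturation_principal[OF assms(2)] by metis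
qed

section \<open>One component of a saturation\<close>

text \<open>An element over \<open>l\<close> is linked to \<open>N\<close> by a chain of multiples
  of generating pairs of \<open>\<rho>\<close>. After the last entry of the chain into the component
  of \<open>l\<close>, only pairs with both ends over \<open>l\<close> occur. The proof replaces
  such chains by the minimality of \<open>\<rho>\<close>.\<close>

lemma fg_fibre_Image:
  fixes N :: "('x \<times> 's) set"
  assumes \<rho>: "fg_act_congruence (free_act_carrier X) free_action \<rho>"
    and l: "l \<in> X"
    and N: "N \<subseteq> free_act_carrier X" "fg_right_ideal (fibre N l)"
    and others: "\<And>m. m \<in> X \<Longrightarrow> m \<noteq> l \<Longrightarrow> fg_right_ideal (fibre (\<rho> `` N) m)"
  shows "fg_right_ideal (fibre (\<rho> `` N) l)"
proof -
  let ?M = "\<rho> `` N"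
  obtain H where \<rho>c: "act_congruence (free_act_carrier X) free_action \<rho>"
    and H: "finite H" "H \<subseteq> \<rho>"
    and min: "\<And>\<sigma>. act_congruence (free_act_carrier X) free_action \<sigma> \<Longrightarrow> H \<subseteq> \<sigma> \<Longrightarrow> \<rho> \<subseteq> \<sigma>"
    by (rule fg_act_congruenceE[OF \<rho>]) (rule that)
  note D = act_congruenceD[OF \<rho>c]
  have M_sat: "q \<in> ?M" if "p \<in> ?M" "(p, q) \<in> \<rho>" for p q
  proof -
    from that(1) obtain n where "n \<in> N" "(n, p) \<in> \<rho>" by blast
    then show ?thesis
      using D(5)[OF _ that(2)] by blast
  qed
  have M_iff: "free_action p s \<in> ?M \<longleftrightarrow> free_action q s \<in> ?M" if "(p, q) \<in> \<rho>" for p q s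
    using M_sat[OF _ D(6)[OF that, of s]] M_sat[OF _ D(4)[OF D(6)[OF that, of s]]] by blast
  \<comment> \<open>Generating pairs with one end over \<open>l\<close>, turned so that they lead
    into the component of \<open>l\<close>.\<close>
  define H' where "H' = {(d, c). (d, c) \<in> H \<union> H\<inverse> \<and> fst d \<noteq> l \<and> fst c = l}"
  have "finite H'"
    by (rule finite_subset[of _ "H \<union> H\<inverse>"]) (use H(1) in \<open>auto simp: H'_def\<close>)
  have H'_\<rho>: "(d, c) \<in> \<rho>" if "(d, c) \<in> H'" for d c
    using that H(2) D(4)[of c d] by (auto simp: H'_def)
  \<comment> \<open>The points of entry: the part of \<open>N\<close> over \<open>l\<close>, and
    \<open>c t\<close> for each such pair \<open>(d, c)\<close> and each \<open>t\<close> with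
    \<open>d t\<close> in \<open>?M\<close>.\<close>
  define Q where "Q = fibre N l \<union>
    (\<Union>(d, c)\<in>H'. (*) (snd c) ` residual (fibre ?M (fst d)) (snd d))"
  have "fg_right_ideal Q"
    unfolding Q_def
  proof (intro fg_right_ideal_Un fg_right_ideal_UN N \<open>finite H'\<close>)
    fix e assume "e \<in> H'"
    then obtain d c where e: "e = (d, c)" "(d, c) \<in> H'" by (cases e) auto
    then have "fst d \<in> X" "fst d \<noteq> l"
      using D(1)[OF H'_\<rho>[OF e(2)]] by (auto simp: mem_free_act_carrier H'_def)
    then show "fg_right_ideal (case e of (d, c) \<Rightarrow>
        (*) (snd c) ` residual (fibre ?M (fst d)) (snd d))"
      unfolding e(1) prod.case by (intro fg_right_ideal_image_mult fg_residual others)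
  qed
  \<comment> \<open>This may be smaller than the restriction of \<open>\<rho>\<close> to the
    component of \<open>l\<close>, but it is finitely generated by construction.\<close>
  define \<tau> where "\<tau> = generated_congruence UNIV (*) {(c, d). ((l, c), (l, d)) \<in> H}"
  have "finite {(c, d). ((l, c), (l, d)) \<in> H}"
    using finite_vimageI[OF H(1), of "\<lambda>e. ((l, fst e), (l, snd e))"]
    by (simp add: vimage_def inj_def prod_eq_iff case_prod_unfold)
  then have \<tau>_fg: "fg_right_congruence \<tau>"
    unfolding \<tau>_def fg_right_congruence_iff
    by (rule fg_act_congruence_generated[OF right_act_regular]) simp
  have \<tau>c: "act_congruence UNIV (*) \<tau>"
    unfolding \<tau>_def by (rule act_congruence_generated[OF right_act_regular])
  note T = act_congruenceD[OF \<tau>c]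
  have "act_congruence UNIV (*) {(c, d). ((l, c), (l, d)) \<in> \<rho>}"
  proof (rule act_congruenceI)
    fix a b c s
    show "(a, a) \<in> {(c, d). ((l, c), (l, d)) \<in> \<rho>}"
      using l by (simp add: D(3) mem_free_act_carrier)
    show "(a, b) \<in> {(c, d). ((l, c), (l, d)) \<in> \<rho>} \<Longrightarrow> (b, a) \<in> {(c, d). ((l, c), (l, d)) \<in> \<rho>}"
      by (simp add: D(4))
    show "(a, b) \<in> {(c, d). ((l, c), (l, d)) \<in> \<rho>} \<Longrightarrow> (b, c) \<in> {(c, d). ((l, c), (l, d)) \<in> \<rho>}
        \<Longrightarrow> (a, c) \<in> {(c, d). ((l, c), (l, d)) \<in> \<rho>}"
      using D(5) by blast
    show "(a, b) \<in> {(c, d). ((l, c), (l, d)) \<in> \<rho>}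
        \<Longrightarrow> (a * s, b * s) \<in> {(c, d). ((l, c), (l, d)) \<in> \<rho>}"
      using D(6)[of "(l, a)" "(l, b)" s] by (simp add: free_action_Pair)
  qed simp
  then have "\<tau> \<subseteq> {(c, d). ((l, c), (l, d)) \<in> \<rho>}"
    unfolding \<tau>_def by (rule generated_congruence_subset) (use H(2) in auto)
  then have \<tau>_\<rho>: "((l, c), (l, d)) \<in> \<rho>" if "(c, d) \<in> \<tau>" for c d
    using that by blast
  have "fibre ?M l = saturation Q \<tau>"
  proof
    have "(l, s) \<in> ?M" if "s \<in> Q" for s
      using that unfolding Q_def
    proof
      assume "s \<in> fibre N l"
      then show ?thesis
        using N(1) D(3) by (auto simp: fibre_def)
    next
      assume "s \<in> (\<Union>(d, c)\<in>H'. (*) (snd c) ` residual (fibre ?M (fst d)) (snd d))"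
      then obtain d c where dc: "(d, c) \<in> H'"
        and "s \<in> (*) (snd c) ` residual (fibre ?M (fst d)) (snd d)"
        by blast
      then obtain t where t: "s = snd c * t" "(fst d, snd d * t) \<in> ?M"
        unfolding residual_def fibre_def by blast
      have "fst c = l"
        using dc by (simp add: H'_def)
      then have "((fst d, snd d * t), (l, s)) \<in> \<rho>"
        using D(6)[OF H'_\<rho>[OF dc], of t] t(1) by (simp add: free_action_def)
      with t(2) show ?thesis
        by (rule M_sat)
    qed
    then show TM: "saturation Q \<tau> \<subseteq> fibre ?M l"
      using M_sat[OF _ D(4)[OF \<tau>_\<rho>]] unfolding saturation_def fibre_def by blast
    have T_\<tau>: "c \<in> saturation Q \<tau> \<longleftrightarrow> d \<in> saturation Q \<tau>" if "(c, d) \<in> \<tau>" for c d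
      using T(5)[OF that] T(5)[OF T(4)[OF that]] by (auto simp: saturation_def)
    have QT: "Q \<subseteq> saturation Q \<tau>"
      using T(3) by (auto simp: saturation_def)
    \<comment> \<open>\<open>M'\<close> is the expected description of \<open>?M\<close>, and
      \<open>\<sigma>\<close> is the largest congruence for which \<open>M'\<close> is a union of
      classes. Once \<open>\<sigma>\<close> contains \<open>H\<close> it contains
      \<open>\<rho>\<close>; as \<open>N \<subseteq> M'\<close>, this gives
      \<open>?M \<subseteq> M'\<close>.\<close>
    define M' where "M' = {p \<in> ?M. fst p \<noteq> l} \<union> {l} \<times> saturation Q \<tau>"
    define \<sigma> where "\<sigma> = {(p, q). p \<in> free_act_carrier X \<and> q \<in> free_act_carrier X \<and>
      (\<forall>s. free_action p s \<in> M' \<longleftrightarrow> free_action q s \<in> M')}"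
    have "act_congruence (free_act_carrier X) free_action \<sigma>"
      by (rule act_congruenceI)
        (auto simp: \<sigma>_def free_act_simps free_action_mult[symmetric])
    moreover have "H \<subseteq> \<sigma>"
    proof
      fix e assume "e \<in> H"
      then obtain p q where e: "e = (p, q)" "(p, q) \<in> H" by (cases e) auto
      then have pq: "(p, q) \<in> \<rho>"
        using H(2) by blast
      \<comment> \<open>Forwards, \<open>c s\<close> is a point of entry and lies over
        \<open>Q\<close>; backwards, \<open>TM\<close> puts \<open>c s\<close> into
        \<open>?M\<close>, and saturation carries this over to \<open>d s\<close>.\<close>
      have cross: "free_action d s \<in> ?M \<longleftrightarrow> snd c * s \<in> saturation Q \<tau>"
        if dc: "(d, c) \<in> H'" for d c s
      proof
        assume "free_action d s \<in> ?M"
        then have "snd c * s \<in> Q"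
          unfolding Q_def using dc
          by (auto intro!: bexI[OF _ dc] imageI simp: residual_def fibre_def free_action_def)
        then show "snd c * s \<in> saturation Q \<tau>"
          using QT by blast
      next
        assume "snd c * s \<in> saturation Q \<tau>"
        then have "free_action c s \<in> ?M"
          using TM dc by (auto simp: fibre_def free_action_def H'_def)
        then show "free_action d s \<in> ?M"
          using M_iff[OF H'_\<rho>[OF dc]] by blast
      qed
      have "free_action p s \<in> M' \<longleftrightarrow> free_action q s \<in> M'" for s
      proof -
        consider "fst p \<noteq> l" "fst q \<noteq> l" | "fst p = l" "fst q = l"
          | "fst p \<noteq> l" "fst q = l" | "fst p = l" "fst q \<noteq> l" by blast
        then show ?thesis
        proof cases
          case 1
          then show ?thesis
            using M_iff[OF pq] by (auto simp: M'_def free_action_def)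
        next
          case 2
          then have "(snd p, snd q) \<in> \<tau>"
            using e(2) unfolding \<tau>_def
            by (intro generated_congruence.base) (auto, metis prod.collapse)
          then show ?thesis
            using 2 T_\<tau>[OF T(6), of "snd p" "snd q" s] by (simp add: M'_def free_action_def)
        next
          case 3
          then have "(p, q) \<in> H'"
            using e(2) by (simp add: H'_def)
          from cross[OF this] 3 show ?thesis
            by (simp add: M'_def free_action_def mem_Times_iff)
        next
          case 4
          then have "(q, p) \<in> H'"
            using e(2) by (simp add: H'_def)
          from cross[OF this] 4 show ?thesis
            by (simp add: M'_def free_action_def mem_Times_iff)
        qed
      qed
      then show "e \<in> \<sigma>"
        using e pq D(1,2) by (auto simp: \<sigma>_def)
    qed
    ultimately have \<rho>\<sigma>: "\<rho> \<subseteq> \<sigma>"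
      by (rule min)
    have "N \<subseteq> M'"
    proof
      fix p assume p: "p \<in> N"
      then have "p \<in> ?M"
        using N(1) D(3) by blast
      moreover have "snd p \<in> saturation Q \<tau>" if "fst p = l"
        using QT p that by (auto simp: Q_def fibre_def)
      ultimately show "p \<in> M'"
        by (auto simp: M'_def mem_Times_iff)
    qed
    show "fibre ?M l \<subseteq> saturation Q \<tau>"
    proof
      fix s assume "s \<in> fibre ?M l"
      then obtain p where p: "p \<in> N" "(p, (l, s)) \<in> \<rho>"
        by (auto simp: fibre_def)
      then have "free_action p 1 \<in> M' \<longleftrightarrow> free_action (l, s) 1 \<in> M'"
        using \<rho>\<sigma> by (auto simp: \<sigma>_def)
      then show "s \<in> saturation Q \<tau>"
        using p(1) \<open>N \<subseteq> M'\<close> by (auto simp: M'_def free_action_1)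
    qed
  qed
  then show ?thesis
    using fg_saturation[OF \<open>fg_right_ideal Q\<close> \<tau>_fg] by simp
qed


section \<open>Presenting a saturated finitely generated subact modulo a congruence\<close>

text \<open>The pullback is the kernel of F(Y) \<rightarrow> J/\<rho>, which is onto by
  \<open>gen\<close>. A finite part \<open>G\<close> of it generates it as soon as the map from
  \<open>J\<close> to F(Y) modulo \<open>G\<close>, sending generators of \<open>J\<close> to lifts,
  is well defined, constant on \<open>\<rho>\<close>-classes, and takes \<open>g y\<close> back to
  \<open>y\<close>. Each of these three demands reduces to finitely many pairs of the
  kernel.\<close>

lemma fg_pullback:
  fixes X :: "'x set" and Y :: "'y set" and \<rho> :: "(('x \<times> 's) \<times> ('x \<times> 's)) set"
  assumes \<rho>: "fg_act_congruence (free_act_carrier X) free_action \<rho>"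
    and fin: "finite X" "finite Y"
    and J: "J \<subseteq> free_act_carrier X" "\<And>x. x \<in> X \<Longrightarrow> fg_right_ideal (fibre J x)"
    and J_sat: "\<And>p q. p \<in> J \<Longrightarrow> (p, q) \<in> \<rho> \<Longrightarrow> q \<in> J"
    and g: "\<And>y. y \<in> Y \<Longrightarrow> g y \<in> J"
    and gen: "\<And>p. p \<in> J \<Longrightarrow> \<exists>y\<in>Y. \<exists>s. (p, free_action (g y) s) \<in> \<rho>"
  shows "fg_act_congruence (free_act_carrier Y) free_action (pullback Y g \<rho>)"
proof -
  obtain H where \<rho>c: "act_congruence (free_act_carrier X) free_action \<rho>"
    and H: "finite H" "H \<subseteq> \<rho>"
    and min: "\<And>\<sigma>. act_congruence (free_act_carrier X) free_action \<sigma> \<Longrightarrow> H \<subseteq> \<sigma> \<Longrightarrow> \<rho> \<subseteq> \<sigma>"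
    by (rule fg_act_congruenceE[OF \<rho>]) (rule that)
  note D = act_congruenceD[OF \<rho>c]
  let ?\<kappa> = "pullback Y g \<rho>"
  have \<kappa>c: "act_congruence (free_act_carrier Y) free_action ?\<kappa>"
    by (rule act_congruence_pullback[OF \<rho>c]) (use g J(1) in blast)
  define C :: "(('y \<times> 's) \<times> ('y \<times> 's)) set \<Rightarrow> _"
    where "C = generated_congruence (free_act_carrier Y) free_action"
  have Cc: "act_congruence (free_act_carrier Y) free_action (C G)" for G
    unfolding C_def by (rule act_congruence_generated[OF right_act_free])
  note C = act_congruenceD[OF Cc]
  define E where "E w = free_action (g (fst w)) (snd w)" for w
  have E_act: "E (free_action w s) = free_action (E w) s" for w s
    by (simp add: E_def free_act_simps snd_free_action free_action_mult)
  \<comment> \<open>Each pair of the kernel lies in \<open>C G\<close> for all large finite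
    \<open>G\<close>, so finitely many such pairs can be treated together.\<close>
  have ev: "\<forall>\<^sub>F G in finite_subsets_at_top ?\<kappa>. (v, w) \<in> C G"
    if "fst v \<in> Y" "fst w \<in> Y" "(E v, E w) \<in> \<rho>" for v w
    unfolding C_def by (rule eventually_mem_generated_congruence[OF \<kappa>c])
      (use that in \<open>simp add: pullback_def mem_free_act_carrier E_def\<close>)

  have "\<forall>x\<in>X. \<exists>F. finite F \<and> fibre J x = (\<Union>a\<in>F. principal_right_ideal a)"
    using J(2) fg_right_ideal_iff by blast
  then obtain F where F: "\<forall>x\<in>X. finite (F x) \<and> fibre J x = (\<Union>a\<in>F x. principal_right_ideal a)"
    using bchoice[of X "\<lambda>x F. finite F \<and> fibre J x = (\<Union>a\<in>F. principal_right_ideal a)"] by blast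
  \<comment> \<open>Generators of \<open>J\<close>, collected from its fibres; \<open>h\<close>
    below lifts each of them to F(Y) modulo \<open>\<rho>\<close>.\<close>
  define A where "A = Sigma X F"
  have "finite A"
    unfolding A_def using F fin(1) by blast
  have J_iff: "p \<in> J \<longleftrightarrow> (\<exists>a\<in>A. \<exists>s. p = free_action a s)" for p
  proof (cases "fst p \<in> X")
    case True
    have "p \<in> J \<longleftrightarrow> snd p \<in> fibre J (fst p)"
      by (simp add: fibre_def)
    also have "\<dots> \<longleftrightarrow> (\<exists>\<alpha>\<in>F (fst p). \<exists>s. snd p = \<alpha> * s)"
      using F True by (simp add: mem_principal_right_ideal)
    also have "\<dots> \<longleftrightarrow> (\<exists>a\<in>A. \<exists>s. p = free_action a s)"
      using True by (auto simp: A_def free_action_def prod_eq_iff)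
    finally show ?thesis .
  next
    case False
    then show ?thesis
      using J(1) by (auto simp: A_def free_action_def mem_free_act_carrier)
  qed
  have A_J: "a \<in> J" if "a \<in> A" for a
    unfolding J_iff using that free_action_1[of a] by metis
  have "\<exists>w. fst w \<in> Y \<and> (a, E w) \<in> \<rho>" if a: "a \<in> A" for a
  proof -
    obtain y s where "y \<in> Y" "(a, free_action (g y) s) \<in> \<rho>"
      using gen[OF A_J[OF a]] by blast
    then show ?thesis
      by (intro exI[of _ "(y, s)"]) (simp add: E_def)
  qed
  then obtain h where h: "\<And>a. a \<in> A \<Longrightarrow> fst (h a) \<in> Y" "\<And>a. a \<in> A \<Longrightarrow> (a, E (h a)) \<in> \<rho>"
    by metis
  \<comment> \<open>A multivalued morphism from \<open>J\<close> to the free act on \<open>Y\<close>; \<open>G\<close> is chosen below so that it becomes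
    single-valued and compatible with \<open>\<rho>\<close> modulo the congruence generated by \<open>G\<close>.\<close>
  define \<phi> where "\<phi> p w \<longleftrightarrow> (\<exists>a\<in>A. \<exists>s. p = free_action a s \<and> w = free_action (h a) s)" for p w
  have \<phi>_ex: "\<exists>w. \<phi> p w" if "p \<in> J" for p
    using that unfolding J_iff \<phi>_def by blast
  have \<phi>_J: "p \<in> J" if "\<phi> p w" for p w
    using that unfolding J_iff \<phi>_def by blast
  have \<phi>_act: "\<phi> (free_action p s) (free_action w s)" if "\<phi> p w" for p w s
    using that unfolding \<phi>_def
    by (clarsimp simp: free_action_mult[symmetric] simp del: split_paired_Ex) blast
  have \<phi>_Y: "fst w \<in> Y" if "\<phi> p w" for p w
    using that h(1) by (auto simp: \<phi>_def fst_free_action)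
  have \<phi>_E: "(p, E w) \<in> \<rho>" if "\<phi> p w" for p w
    using that D(6)[OF h(2)] by (auto simp: \<phi>_def E_act)

  \<comment> \<open>Well-definedness. On second coordinates, the relations \<open>a s = b t\<close>
    have finitely many sources: the idempotents \<open>a' a\<close> and \<open>b' b\<close> given by
    regularity, and the generators \<open>z = a u = b v\<close> of the intersection of the two
    principal right ideals.\<close>
  have "\<forall>\<^sub>F G in finite_subsets_at_top ?\<kappa>. \<forall>s t. free_action a s = free_action b t \<longrightarrow>
      (free_action (h a) s, free_action (h b) t) \<in> C G" if ab: "a \<in> A" "b \<in> A" for a b
  proof (cases "fst a = fst b")
    case False
    then show ?thesis
      by (simp add: free_action_def)
  next
    case True
    obtain a' where a': "snd a = snd a * a' * snd a"
      using regular by blast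
    obtain b' where b': "snd b = snd b * b' * snd b"
      using regular by blast
    obtain Z where Z: "finite Z"
      "principal_right_ideal (snd a) \<inter> principal_right_ideal (snd b) = (\<Union>z\<in>Z. principal_right_ideal z)"
      using fg_inter_principal[of "snd a" "snd b", unfolded fg_right_ideal_iff]
      by (elim exE conjE) (rule that)
    have *: "(\<exists>u. z = snd a * u) \<and> (\<exists>v. z = snd b * v)" if "z \<in> Z" for z
    proof -
      have "z \<in> (\<Union>z\<in>Z. principal_right_ideal z)"
        using that self_mem_principal_right_ideal by blast
      then show ?thesis
        unfolding Z(2)[symmetric] by (simp add: mem_principal_right_ideal)
    qed
    obtain u where u: "\<forall>z\<in>Z. z = snd a * u z"
      using bchoice[of Z "\<lambda>z u. z = snd a * u"] * by blast
    obtain v where v: "\<forall>z\<in>Z. z = snd b * v z"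
      using bchoice[of Z "\<lambda>z v. z = snd b * v"] * by blast
    note uv = u[rule_format] v[rule_format]
    \<comment> \<open>Right multiplication by \<open>c' * snd c\<close> fixes \<open>c\<close>, so
      this pair lies in the kernel. Modulo it, \<open>h c\<close> times \<open>s\<close> depends
      only on \<open>snd c * s\<close>, which is what \<open>transfer\<close> exploits.\<close>
    have idem: "\<forall>\<^sub>F G in finite_subsets_at_top ?\<kappa>. (h c, free_action (h c) (c' * snd c)) \<in> C G"
      if c: "c \<in> A" and c': "snd c = snd c * c' * snd c" for c c'
    proof (rule ev)
      have "free_action c (c' * snd c) = c"
        using c' by (simp add: free_action_def mult.assoc)
      then have "(c, E (free_action (h c) (c' * snd c))) \<in> \<rho>"
        using D(6)[OF h(2)[OF c], of "c' * snd c"] by (simp add: E_act)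
      then show "(E (h c), E (free_action (h c) (c' * snd c))) \<in> \<rho>"
        using D(4)[OF h(2)[OF c]] D(5) by blast
    qed (use h(1) c in \<open>simp_all add: fst_free_action\<close>)
    have "\<forall>\<^sub>F G in finite_subsets_at_top ?\<kappa>.
        (free_action (h a) (u z), free_action (h b) (v z)) \<in> C G" if z: "z \<in> Z" for z
    proof (rule ev)
      have "free_action a (u z) = free_action b (v z)"
        using uv[OF z] True by (simp add: free_action_def)
      then show "(E (free_action (h a) (u z)), E (free_action (h b) (v z))) \<in> \<rho>"
        using D(6)[OF h(2)[OF ab(1)], of "u z"] D(6)[OF h(2)[OF ab(2)], of "v z"]
        by (simp add: E_act) (rule D(5)[OF D(4)])
    qed (use h(1) ab in \<open>simp_all add: fst_free_action\<close>)
    then have "\<forall>\<^sub>F G in finite_subsets_at_top ?\<kappa>. \<forall>z\<in>Z.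
        (free_action (h a) (u z), free_action (h b) (v z)) \<in> C G"
      by (intro eventually_ball_finite Z(1)) blast
    then show ?thesis
      using idem[OF ab(1) a'] idem[OF ab(2) b']
    proof eventually_elim
      case (elim G)
      show ?case
      proof (intro allI impI)
        fix s t assume st: "free_action a s = free_action b t"
        then have "snd a * s = snd b * t"
          by (simp add: free_action_def)
        then have "snd a * s \<in> (\<Union>z\<in>Z. principal_right_ideal z)"
          unfolding Z(2)[symmetric] Int_iff mem_principal_right_ideal by blast
        then obtain z r where z: "z \<in> Z" "snd a * s = z * r"
          by (auto simp: mem_principal_right_ideal)
        have transfer: "(free_action (h c) s', free_action (h c) (w * r)) \<in> C G"
          if c: "(h c, free_action (h c) (c' * snd c)) \<in> C G"
            and s': "snd c * s' = z * r" and w: "z = snd c * w" for c c' s' w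
        proof -
          have "c' * snd c * s' = c' * snd c * (w * r)"
            using s' w by (simp add: mult.assoc)
          then have "free_action (free_action (h c) (c' * snd c)) s' =
              free_action (free_action (h c) (c' * snd c)) (w * r)"
            by (simp add: free_action_mult[symmetric])
          then show ?thesis
            using C(5)[OF C(6)[OF c, of s'], of "free_action (h c) (w * r)"]
              C(4)[OF C(6)[OF c, of "w * r"]] by simp
        qed
        have 1: "(free_action (h a) s, free_action (h a) (u z * r)) \<in> C G"
          using transfer[OF elim(2) z(2) uv(1)[OF z(1)]] .
        have 2: "(free_action (h b) t, free_action (h b) (v z * r)) \<in> C G"
          using transfer[OF elim(3) _ uv(2)[OF z(1)]] z(2) \<open>snd a * s = snd b * t\<close> by simp
        have 3: "(free_action (h a) (u z * r), free_action (h b) (v z * r)) \<in> C G"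
          unfolding free_action_mult by (rule C(6)) (use elim(1) z(1) in blast)
        show "(free_action (h a) s, free_action (h b) t) \<in> C G"
          by (rule C(5)[OF 1 C(5)[OF 3 C(4)[OF 2]]])
      qed
    qed
  qed
  then have "\<forall>\<^sub>F G in finite_subsets_at_top ?\<kappa>. \<forall>a\<in>A. \<forall>b\<in>A. \<forall>s t.
      free_action a s = free_action b t \<longrightarrow> (free_action (h a) s, free_action (h b) t) \<in> C G"
    by (intro eventually_ball_finite ballI \<open>finite A\<close>) blast
  then have ev1: "\<forall>\<^sub>F G in finite_subsets_at_top ?\<kappa>. \<forall>p v w. \<phi> p v \<longrightarrow> \<phi> p w \<longrightarrow> (v, w) \<in> C G"
    by eventually_elim (auto simp: \<phi>_def)

  \<comment> \<open>Constancy on \<open>\<rho>\<close>-classes. A multiple of a generating pair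
    matters only if it lies in \<open>J\<close>. The multipliers in question form a residual of a
    fibre of \<open>J\<close>, and one kernel pair for each of its finitely many generators settles
    them all.\<close>
  have "\<forall>\<^sub>F G in finite_subsets_at_top ?\<kappa>. \<forall>s. free_action (fst e) s \<in> J \<longrightarrow>
      (\<exists>v w. \<phi> (free_action (fst e) s) v \<and> \<phi> (free_action (snd e) s) w \<and> (v, w) \<in> C G)"
    if e: "e \<in> H" for e
  proof -
    define p q where "p = fst e" and "q = snd e"
    have pq: "(p, q) \<in> \<rho>"
      using e H(2) by (auto simp: p_def q_def)
    have "fst p \<in> X"
      using D(1)[OF pq] by (simp add: mem_free_act_carrier)
    then have "fg_right_ideal (residual (fibre J (fst p)) (snd p))"
      by (intro fg_residual J(2))
    then obtain K where K: "finite K"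
      "residual (fibre J (fst p)) (snd p) = (\<Union>k\<in>K. principal_right_ideal k)"
      unfolding fg_right_ideal_iff by (elim exE conjE) (rule that)
    have mem: "free_action p t \<in> J \<longleftrightarrow> (\<exists>k\<in>K. \<exists>r. t = k * r)" for t
    proof -
      have "free_action p t \<in> J \<longleftrightarrow> t \<in> residual (fibre J (fst p)) (snd p)"
        by (simp add: free_action_def residual_def fibre_def)
      then show ?thesis
        unfolding K(2) by (simp add: mem_principal_right_ideal)
    qed
    have "\<exists>v w. \<phi> (free_action p k) v \<and> \<phi> (free_action q k) w" if "k \<in> K" for k
    proof -
      have "free_action p k \<in> J"
        unfolding mem using that mult_1_right[of k] by metis
      moreover from this have "free_action q k \<in> J"
        using J_sat D(6)[OF pq] by blast
      ultimately show ?thesis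
        using \<phi>_ex by blast
    qed
    then obtain v w where vw: "\<And>k. k \<in> K \<Longrightarrow> \<phi> (free_action p k) (v k)"
        "\<And>k. k \<in> K \<Longrightarrow> \<phi> (free_action q k) (w k)"
      by metis
    have "\<forall>\<^sub>F G in finite_subsets_at_top ?\<kappa>. (v k, w k) \<in> C G" if k: "k \<in> K" for k
    proof (rule ev)
      show "fst (v k) \<in> Y" "fst (w k) \<in> Y"
        using vw[OF k] \<phi>_Y by blast+
      show "(E (v k), E (w k)) \<in> \<rho>"
        by (rule D(5)[OF D(4)[OF \<phi>_E[OF vw(1)[OF k]]] D(5)[OF D(6)[OF pq] \<phi>_E[OF vw(2)[OF k]]]])
    qed
    then have "\<forall>\<^sub>F G in finite_subsets_at_top ?\<kappa>. \<forall>k\<in>K. (v k, w k) \<in> C G"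
      by (intro eventually_ball_finite K(1)) blast
    then show ?thesis
    proof eventually_elim
      case (elim G)
      have "\<exists>v w. \<phi> (free_action p s) v \<and> \<phi> (free_action q s) w \<and> (v, w) \<in> C G"
        if s: "free_action p s \<in> J" for s
      proof -
        obtain k r where k: "k \<in> K" "s = k * r"
          using s mem by blast
        have "\<phi> (free_action p s) (free_action (v k) r)" "\<phi> (free_action q s) (free_action (w k) r)"
          unfolding k(2) free_action_mult by (intro \<phi>_act vw k(1))+
        moreover have "(free_action (v k) r, free_action (w k) r) \<in> C G"
          using elim k(1) by (intro C(6)) blast
        ultimately show ?thesis by blast
      qed
      then show ?case
        by (simp add: p_def q_def)
    qed
  qed
  then have ev2: "\<forall>\<^sub>F G in finite_subsets_at_top ?\<kappa>. \<forall>e\<in>H. \<forall>s. free_action (fst e) s \<in> J \<longrightarrow>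
      (\<exists>v w. \<phi> (free_action (fst e) s) v \<and> \<phi> (free_action (snd e) s) w \<and> (v, w) \<in> C G)"
    by (intro eventually_ball_finite H(1)) blast

  \<comment> \<open>One pair for each \<open>y\<close> makes \<open>(y, 1)\<close> agree with a lift
    of \<open>g y\<close>.\<close>
  have "\<forall>\<^sub>F G in finite_subsets_at_top ?\<kappa>. \<exists>w. \<phi> (g y) w \<and> ((y, 1), w) \<in> C G" if y: "y \<in> Y" for y
  proof -
    obtain w where w: "\<phi> (g y) w"
      using \<phi>_ex[OF g[OF y]] by blast
    have "\<forall>\<^sub>F G in finite_subsets_at_top ?\<kappa>. ((y, 1), w) \<in> C G"
      by (rule ev) (use y \<phi>_Y[OF w] \<phi>_E[OF w] in \<open>simp_all add: E_def free_action_1\<close>)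
    then show ?thesis
      by eventually_elim (use w in blast)
  qed
  then have ev3: "\<forall>\<^sub>F G in finite_subsets_at_top ?\<kappa>. \<forall>y\<in>Y. \<exists>w. \<phi> (g y) w \<and> ((y, 1), w) \<in> C G"
    by (intro eventually_ball_finite fin(2)) blast

  have "\<forall>\<^sub>F G in finite_subsets_at_top ?\<kappa>. finite G \<and> G \<subseteq> ?\<kappa>"
    by (rule eventually_finite_subsets_at_top_weakI) simp
  \<comment> \<open>The filter is proper, so the three eventual conditions hold for a single finite
    part \<open>G\<close> of the kernel.\<close>
  from eventually_happens'[OF finite_subsets_at_top_neq_bot
      eventually_conj[OF this eventually_conj[OF ev1 eventually_conj[OF ev2 ev3]]]]
  obtain G where G: "finite G" "G \<subseteq> ?\<kappa>"
    and G1: "\<forall>p v w. \<phi> p v \<longrightarrow> \<phi> p w \<longrightarrow> (v, w) \<in> C G"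
    and G2: "\<forall>e\<in>H. \<forall>s. free_action (fst e) s \<in> J \<longrightarrow>
      (\<exists>v w. \<phi> (free_action (fst e) s) v \<and> \<phi> (free_action (snd e) s) w \<and> (v, w) \<in> C G)"
    and G3: "\<forall>y\<in>Y. \<exists>w. \<phi> (g y) w \<and> ((y, 1), w) \<in> C G"
    by (elim exE conjE) (rule that)
  note uniq = G1[rule_format] and GH = G2[rule_format] and GY = G3[rule_format]

  \<comment> \<open>quantified over \<open>s\<close> because \<open>p\<close> may lie outside \<open>J\<close> while \<open>p s\<close> lies in \<open>J\<close>\<close>
  define \<sigma> where "\<sigma> = {(p, q). p \<in> free_act_carrier X \<and> q \<in> free_act_carrier X \<and>
    (\<forall>s. (free_action p s \<in> J \<longleftrightarrow> free_action q s \<in> J) \<and>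
      (\<forall>v w. \<phi> (free_action p s) v \<longrightarrow> \<phi> (free_action q s) w \<longrightarrow> (v, w) \<in> C G))}"
  have "act_congruence (free_act_carrier X) free_action \<sigma>"
  proof (rule act_congruenceI)
    fix a b c s
    show "a \<in> free_act_carrier X \<Longrightarrow> (a, a) \<in> \<sigma>"
      by (simp add: \<sigma>_def uniq)
    show "(a, b) \<in> \<sigma> \<Longrightarrow> (b, a) \<in> \<sigma>"
      by (simp add: \<sigma>_def C(4))
    show "(a, b) \<in> \<sigma> \<Longrightarrow> (free_action a s, free_action b s) \<in> \<sigma>"
      by (simp add: \<sigma>_def free_action_mult[symmetric] mem_free_act_carrier fst_free_action)
    \<comment> \<open>Transitivity rests on the clause about \<open>J\<close>: it puts
      \<open>b t\<close> into \<open>J\<close>, so that there is a lift \<open>z\<close> with which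
      to compare \<open>v\<close> and \<open>w\<close>.\<close>
    assume ab: "(a, b) \<in> \<sigma>" and bc: "(b, c) \<in> \<sigma>"
    have "(v, w) \<in> C G" if "\<phi> (free_action a t) v" "\<phi> (free_action c t) w" for t v w
    proof -
      have "free_action b t \<in> J"
        using \<phi>_J[OF that(1)] ab by (simp add: \<sigma>_def)
      then obtain z where z: "\<phi> (free_action b t) z"
        using \<phi>_ex by blast
      have "(v, z) \<in> C G"
        using ab that(1) z unfolding \<sigma>_def by blast
      moreover have "(z, w) \<in> C G"
        using bc that(2) z unfolding \<sigma>_def by blast
      ultimately show ?thesis
        by (rule C(5))
    qed
    then show "(a, c) \<in> \<sigma>"
      using ab bc by (simp add: \<sigma>_def)
  qed (auto simp: \<sigma>_def)
  moreover have "H \<subseteq> \<sigma>"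
  proof
    fix e assume e: "e \<in> H"
    define p q where "p = fst e" and "q = snd e"
    have pq: "(p, q) \<in> \<rho>"
      using e H(2) by (auto simp: p_def q_def)
    have "free_action p s \<in> J \<longleftrightarrow> free_action q s \<in> J" for s
      using J_sat D(6)[OF pq, of s] D(4)[OF D(6)[OF pq, of s]] by blast
    moreover have "(v, w) \<in> C G" if vw: "\<phi> (free_action p s) v" "\<phi> (free_action q s) w" for s v w
    proof -
      \<comment> \<open>\<open>GH\<close> relates one choice of lifts; \<open>uniq\<close> carries
        this over to \<open>v\<close> and \<open>w\<close>.\<close>
      obtain v' w' where *: "\<phi> (free_action p s) v'" "\<phi> (free_action q s) w'" "(v', w') \<in> C G"
        using GH[OF e, of s] \<phi>_J[OF vw(1)] by (auto simp: p_def q_def)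
      show ?thesis
        by (rule C(5)[OF uniq[OF vw(1) *(1)] C(5)[OF *(3) uniq[OF *(2) vw(2)]]])
    qed
    ultimately have "(p, q) \<in> \<sigma>"
      using D(1,2)[OF pq] by (simp add: \<sigma>_def)
    then show "e \<in> \<sigma>"
      by (simp add: p_def q_def)
  qed
  ultimately have \<rho>\<sigma>: "\<rho> \<subseteq> \<sigma>"
    by (rule min)
  \<comment> \<open>Multiplying the relation between \<open>(y, 1)\<close> and a lift of
    \<open>g y\<close> by elements of S shows that every \<open>w\<close> agrees with a lift of its
    image \<open>E w\<close>.\<close>
  have repr: "\<exists>w'. \<phi> (E w) w' \<and> (w, w') \<in> C G" if w: "fst w \<in> Y" for w
  proof -
    obtain w' where "\<phi> (g (fst w)) w'" "((fst w, 1), w') \<in> C G"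
      using GY[OF w] by blast
    then have "\<phi> (E w) (free_action w' (snd w))" "(w, free_action w' (snd w)) \<in> C G"
      using \<phi>_act[of "g (fst w)" w' "snd w"] C(6)[of "(fst w, 1)" w' G "snd w"]
      by (simp_all add: E_def free_action_Pair)
    then show ?thesis by blast
  qed
  show ?thesis
  proof (rule fg_act_congruenceI[OF \<kappa>c G])
    show "?\<kappa> \<subseteq> generated_congruence (free_act_carrier Y) free_action G"
    proof
      fix e assume "e \<in> ?\<kappa>"
      then obtain v w where e: "e = (v, w)" "fst v \<in> Y" "fst w \<in> Y" "(E v, E w) \<in> \<rho>"
        by (auto simp: pullback_def mem_free_act_carrier E_def)
      obtain v' where v': "\<phi> (E v) v'" "(v, v') \<in> C G"
        using repr[OF e(2)] by blast
      obtain w' where w': "\<phi> (E w) w'" "(w, w') \<in> C G"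
        using repr[OF e(3)] by blast
      have "(E v, E w) \<in> \<sigma>"
        using e(4) \<rho>\<sigma> by blast
      then have "\<phi> (free_action (E v) 1) v' \<longrightarrow> \<phi> (free_action (E w) 1) w' \<longrightarrow> (v', w') \<in> C G"
        unfolding \<sigma>_def by blast
      then have "(v', w') \<in> C G"
        using v'(1) w'(1) by (simp add: free_action_1)
      then have "(v, w) \<in> C G"
        by (rule C(5)[OF v'(2) C(5)[OF _ C(4)[OF w'(2)]]])
      then show "e \<in> generated_congruence (free_act_carrier Y) free_action G"
        by (simp add: e(1) C_def)
    qed
  qed
qed

section \<open>Saturations of cyclic subacts\<close>

text \<open>\<open>\<rho>\<close> varies in the induction, since deleting a free generator
  \<open>l\<close> replaces it by its restriction to the remaining components. The generator
  \<open>j\<close> is never deleted, so the cyclic subact stays inside.\<close>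

lemma fg_fibre_saturation:
  assumes "finite X" and "fg_act_congruence (free_act_carrier X) free_action \<rho>"
    and "j \<in> X" and "m \<in> X"
  shows "fg_right_ideal (fibre (\<rho> `` range (free_action (j, a :: 's))) m)"
  using assms
proof (induction X arbitrary: \<rho> m rule: finite_psubset_induct)
  case (psubset X)
  let ?N = "range (free_action (j, a))"
  have "fibre ?N x = (if x = j then principal_right_ideal a else {})" for x
    by (auto simp: fibre_def free_action_Pair mem_principal_right_ideal)
  then have N_fg: "fg_right_ideal (fibre ?N x)" for x
    by (simp add: fg_right_ideal_principal fg_right_ideal_empty)
  have N_X: "?N \<subseteq> free_act_carrier X"
    using psubset.prems(2) by (auto simp: free_action_Pair mem_free_act_carrier)
  show ?case
  proof (cases "X = {j}")
    case True
    \<comment> \<open>There is no component besides that of \<open>j\<close>, so the condition on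
      the others is vacuous.\<close>
    show ?thesis
      by (rule fg_fibre_Image[OF psubset.prems(1,3) N_X N_fg]) (use True psubset.prems(3) in simp)
  next
    case False
    then obtain l where l: "l \<in> X" "l \<noteq> j"
      using psubset.prems(2) by blast
    let ?X' = "X - {l}"
    have \<rho>c: "act_congruence (free_act_carrier X) free_action \<rho>"
      using psubset.prems(1) by (simp add: fg_act_congruence_def)
    note D = act_congruenceD[OF \<rho>c]
    \<comment> \<open>Away from \<open>l\<close> the fibres of this saturation are all of S, so
      \<open>fg_fibre_Image\<close> yields the fibre over \<open>l\<close>.\<close>
    define J where "J = \<rho> `` free_act_carrier ?X'"
    have self_J: "p \<in> J" if "fst p \<in> ?X'" for p
      unfolding J_def by (rule ImageI[OF D(3)]) (use that in \<open>simp_all add: mem_free_act_carrier\<close>)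
    have J_fg': "fg_right_ideal (fibre J x)" if "x \<in> X" "x \<noteq> l" for x
    proof -
      have "fibre J x = UNIV"
        using self_J that by (auto simp: fibre_def)
      then show ?thesis
        by (simp add: fg_right_ideal_UNIV)
    qed
    have "fg_right_ideal (fibre J l)"
      unfolding J_def
    proof (rule fg_fibre_Image[OF psubset.prems(1) l(1)])
      have "fibre (free_act_carrier ?X' :: (_ \<times> 's) set) l = {}"
        by (auto simp: fibre_def mem_free_act_carrier)
      then show "fg_right_ideal (fibre (free_act_carrier ?X' :: (_ \<times> 's) set) l)"
        by (simp add: fg_right_ideal_empty)
    qed (use J_fg' in \<open>auto simp: mem_free_act_carrier J_def\<close>)
    with J_fg' have J_fg: "fg_right_ideal (fibre J x)" if "x \<in> X" for x
      using that by metis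
    \<comment> \<open>With free generators sent to themselves, the pullback is the restriction of
      \<open>\<rho>\<close> to F(X - {l}).\<close>
    define \<rho>' where "\<rho>' = pullback ?X' (\<lambda>x. (x, 1)) \<rho>"
    have \<rho>'_iff: "(p, q) \<in> \<rho>' \<longleftrightarrow> fst p \<in> ?X' \<and> fst q \<in> ?X' \<and> (p, q) \<in> \<rho>" for p q
      by (simp add: \<rho>'_def pullback_def free_action_Pair mem_free_act_carrier)
    have "fg_act_congruence (free_act_carrier ?X') free_action \<rho>'"
      unfolding \<rho>'_def
    proof (rule fg_pullback[OF psubset.prems(1)])
      show "J \<subseteq> free_act_carrier X"
        using D(2) by (auto simp: J_def)
      show "q \<in> J" if "p \<in> J" "(p, q) \<in> \<rho>" for p q
      proof -
        obtain n where n: "n \<in> free_act_carrier ?X'" "(n, p) \<in> \<rho>"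
          using \<open>p \<in> J\<close> by (auto simp: J_def)
        show ?thesis
          unfolding J_def by (rule ImageI[OF D(5)[OF n(2) that(2)] n(1)])
      qed
      show "\<exists>y\<in>?X'. \<exists>s. (p, free_action (y, 1) s) \<in> \<rho>" if "p \<in> J" for p
      proof -
        obtain n where n: "n \<in> free_act_carrier ?X'" "(n, p) \<in> \<rho>"
          using \<open>p \<in> J\<close> by (auto simp: J_def)
        then show ?thesis
          using D(4)[OF n(2)]
          by (intro bexI[of _ "fst n"] exI[of _ "snd n"])
            (simp_all add: free_action_Pair mem_free_act_carrier)
      qed
    qed (use psubset.hyps J_fg self_J in auto)
    then have IH: "fg_right_ideal (fibre (\<rho>' `` ?N) x)" if "x \<in> ?X'" for x
      by (rule psubset.IH[rotated]) (use l psubset.prems(2) that in auto)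
    \<comment> \<open>As \<open>j \<noteq> l\<close>, pairs of \<open>\<rho>\<close> leading from
      \<open>?N\<close> to a component other than that of \<open>l\<close> belong to
      \<open>\<rho>'\<close>, so both congruences saturate \<open>?N\<close> alike there.\<close>
    have others: "fg_right_ideal (fibre (\<rho> `` ?N) x)" if x: "x \<in> X" "x \<noteq> l" for x
    proof -
      have "(n, (x, s)) \<in> \<rho>' \<longleftrightarrow> (n, (x, s)) \<in> \<rho>" if "n \<in> ?N" for n s
        using that x l psubset.prems(2) by (auto simp: \<rho>'_iff fst_free_action)
      then have "fibre (\<rho> `` ?N) x = fibre (\<rho>' `` ?N) x"
        unfolding fibre_def Image_iff by blast
      with IH[of x] x show ?thesis
        by simp
    qed
    show ?thesis
    proof (cases "m = l")
      case True
      show ?thesis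
        unfolding True by (rule fg_fibre_Image[OF psubset.prems(1) l(1) N_X N_fg others])
    qed (rule others[OF psubset.prems(3)])
  qed
qed

section \<open>Finitely generated subacts of finitely presented acts\<close>

text \<open>\<open>B\<close> is presented on an index set \<open>Y\<close> of its generators, with
  the kernel of F(Y) \<rightarrow> B as relations. This kernel is the pullback of
  \<open>\<rho>\<close> along representatives \<open>g y\<close>; \<open>fg_fibre_saturation\<close>
  supplies the finite generation of \<open>J\<close> that \<open>fg_pullback\<close>
  requires.\<close>

lemma fp_act_subact:
  fixes A :: "'b set" and act :: "'b \<Rightarrow> 's \<Rightarrow> 'b"
  assumes A: "fp_act A act" and B: "subact B A act" "fg_act B act"
  shows "fp_act B act"
proof -
  from A obtain X :: "nat set" and \<rho> f where X: "finite X"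
    and \<rho>: "fg_act_congruence (free_act_carrier X) free_action \<rho>"
    and f: "act_iso f A act (free_act_carrier X // \<rho>) (quotient_action free_action \<rho>)"
    unfolding fp_act_def by (elim exE conjE) (rule that)
  have \<rho>c: "act_congruence (free_act_carrier X) free_action \<rho>"
    using \<rho> by (simp add: fg_act_congruence_def)
  note D = act_congruenceD[OF \<rho>c]
  have eq: "equiv (free_act_carrier X) \<rho>"
    using \<rho>c by (simp add: act_congruence_def)
  have f_act: "f (act a s) = quotient_action free_action \<rho> (f a) s" if "a \<in> A" for a s
    using f that by (simp add: act_iso_def)
  have f_inj: "inj_on f A" and f_im: "f ` A = free_act_carrier X // \<rho>"
    using f by (simp_all add: act_iso_def bij_betw_def)
  have BA: "B \<subseteq> A"
    using B(1) by (simp add: subact_def)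
  have act_B: "right_act B act"
    using B(2) by (simp add: fg_act_def)
  obtain F where F: "finite F" "F \<subseteq> B" "B = (\<Union>a\<in>F. {act a s | s. True})"
    using B(2) unfolding fg_act_def by (elim exE conjE) (rule that)
  \<comment> \<open>The generators are numbered because \<open>fp_act\<close> takes free generators
    from the natural numbers.\<close>
  obtain b where "bij_betw b {0..<card F} F"
    using ex_bij_betw_nat_finite[OF F(1)] by blast
  moreover define Y where "Y = {0..<card F}"
  ultimately have bY: "b ` Y = F"
    by (simp add: bij_betw_def)
  have b_B: "b y \<in> B" if "y \<in> Y" for y
    using that bY F(2) by blast
  have "\<exists>p. p \<in> free_act_carrier X \<and> f (b y) = \<rho> `` {p}" if y: "y \<in> Y" for y
  proof -
    have "f (b y) \<in> free_act_carrier X // \<rho>"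
      unfolding f_im[symmetric] using b_B[OF y] BA by blast
    then show ?thesis
      by (rule quotientE) blast
  qed
  then obtain g where g: "\<And>y. y \<in> Y \<Longrightarrow> g y \<in> free_act_carrier X"
      "\<And>y. y \<in> Y \<Longrightarrow> f (b y) = \<rho> `` {g y}"
    by metis
  define E where "E w = free_action (g (fst w)) (snd w)" for w
  \<comment> \<open>\<open>\<beta>\<close> maps F(Y) onto \<open>B\<close>, and \<open>E\<close> is
    its counterpart in F(X): \<open>f\<close> sends \<open>\<beta> w\<close> to the class of
    \<open>E w\<close>.\<close>
  define \<beta> where "\<beta> w = act (b (fst w)) (snd w)" for w
  have E_X: "E w \<in> free_act_carrier X" if "fst w \<in> Y" for w
    using g(1)[OF that] by (simp add: E_def mem_free_act_carrier fst_free_action)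
  have \<beta>_B: "\<beta> w \<in> B" if "fst w \<in> Y" for w
    using act_B b_B[OF that] by (simp add: \<beta>_def right_act_def)
  have f_\<beta>: "f (\<beta> w) = \<rho> `` {E w}" if w: "fst w \<in> Y" for w
  proof -
    have "b (fst w) \<in> A"
      using b_B[OF w] BA by blast
    then show ?thesis
      unfolding \<beta>_def E_def using f_act g(2)[OF w] quotient_action_class[OF \<rho>c g(1)[OF w]] by simp
  qed
  have B_\<beta>: "\<exists>w. fst w \<in> Y \<and> c = \<beta> w" if "c \<in> B" for c
  proof -
    have "\<exists>a\<in>b ` Y. \<exists>s. c = act a s"
      using that F(3) unfolding bY by blast
    then obtain y s where "y \<in> Y" "c = act (b y) s"
      by blast
    then show ?thesis
      by (intro exI[of _ "(y, s)"]) (simp add: \<beta>_def)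
  qed
  have \<beta>_act: "act (\<beta> w) s = \<beta> (free_action w s)" if "fst w \<in> Y" for w s
    using act_B b_B[OF that] by (simp add: \<beta>_def right_act_def fst_free_action snd_free_action)

  define \<kappa> where "\<kappa> = pullback Y g \<rho>"
  have \<kappa>_iff: "(v, w) \<in> \<kappa> \<longleftrightarrow> fst v \<in> Y \<and> fst w \<in> Y \<and> (E v, E w) \<in> \<rho>" for v w
    by (simp add: \<kappa>_def pullback_def mem_free_act_carrier E_def)
  \<comment> \<open>The preimage of \<open>B\<close> in F(X), under the identification of
    \<open>A\<close> with F(X)/\<rho>.\<close>
  define J where "J = (\<Union>y\<in>Y. \<rho> `` range (free_action (g y)))"
  have J_iff: "p \<in> J \<longleftrightarrow> (\<exists>y\<in>Y. \<exists>s. (free_action (g y) s, p) \<in> \<rho>)" for p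
    by (simp add: J_def Image_iff)
  have \<kappa>: "fg_act_congruence (free_act_carrier Y) free_action \<kappa>"
    unfolding \<kappa>_def
  proof (rule fg_pullback[OF \<rho> X])
    show "finite Y"
      by (simp add: Y_def)
    show "J \<subseteq> free_act_carrier X"
      using D(2) by (auto simp: J_def)
    show "fg_right_ideal (fibre J x)" if "x \<in> X" for x
    proof -
      have "fibre J x = (\<Union>y\<in>Y. fibre (\<rho> `` range (free_action (g y))) x)"
        by (auto simp: J_def fibre_def)
      moreover have "fg_right_ideal (fibre (\<rho> `` range (free_action (g y))) x)" if "y \<in> Y" for y
        using fg_fibre_saturation[OF X \<rho> _ \<open>x \<in> X\<close>, of "fst (g y)" "snd (g y)"] g(1)[OF that]
        by (simp add: mem_free_act_carrier)
      ultimately show ?thesis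
        by (simp add: fg_right_ideal_UN[OF \<open>finite Y\<close>])
    qed
    show "q \<in> J" if "p \<in> J" "(p, q) \<in> \<rho>" for p q
    proof -
      obtain y s where y: "y \<in> Y" "(free_action (g y) s, p) \<in> \<rho>"
        using \<open>p \<in> J\<close> unfolding J_iff by blast
      show ?thesis
        unfolding J_iff by (intro bexI[OF _ y(1)] exI[of _ s] D(5)[OF y(2) that(2)])
    qed
    show "g y \<in> J" if "y \<in> Y" for y
      unfolding J_iff
      by (intro bexI[OF _ that] exI[of _ 1]) (simp add: free_action_1 D(3) g(1) that)
    show "\<exists>y\<in>Y. \<exists>s. (p, free_action (g y) s) \<in> \<rho>" if "p \<in> J" for p
    proof -
      obtain y s where y: "y \<in> Y" "(free_action (g y) s, p) \<in> \<rho>"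
        using \<open>p \<in> J\<close> unfolding J_iff by blast
      show ?thesis
        by (intro bexI[OF _ y(1)] exI[of _ s] D(4)[OF y(2)])
    qed
  qed
  have \<kappa>c: "act_congruence (free_act_carrier Y) free_action \<kappa>"
    using \<kappa> by (simp add: fg_act_congruence_def)

  \<comment> \<open>The inverse of the isomorphism F(Y)/\<kappa> \<rightarrow> B induced by
    \<open>\<beta>\<close>: for \<open>c\<close> in \<open>B\<close>, the preimages of
    \<open>c\<close> form a \<open>\<kappa>\<close>-class.\<close>
  define k where "k c = {w. fst w \<in> Y \<and> \<beta> w = c}" for c
  have \<beta>_eq: "\<beta> v = \<beta> w \<longleftrightarrow> (v, w) \<in> \<kappa>" if "fst v \<in> Y" "fst w \<in> Y" for v w
  proof -
    have "\<beta> v = \<beta> w \<longleftrightarrow> f (\<beta> v) = f (\<beta> w)"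
      by (rule inj_on_eq_iff[OF f_inj, symmetric]) (use \<beta>_B that BA in blast)+
    also have "\<dots> \<longleftrightarrow> (v, w) \<in> \<kappa>"
      using eq_equiv_class_iff[OF eq E_X E_X] that by (simp add: f_\<beta> \<kappa>_iff)
    finally show ?thesis .
  qed
  have k_\<beta>: "k (\<beta> w) = \<kappa> `` {w}" if w: "fst w \<in> Y" for w
  proof (rule set_eqI)
    fix v
    have "v \<in> k (\<beta> w) \<longleftrightarrow> fst v \<in> Y \<and> \<beta> w = \<beta> v"
      by (auto simp: k_def)
    also have "\<dots> \<longleftrightarrow> (w, v) \<in> \<kappa>"
      using \<beta>_eq[OF w, of v] \<kappa>_iff[of w v] by blast
    finally show "v \<in> k (\<beta> w) \<longleftrightarrow> v \<in> \<kappa> `` {w}"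
      by simp
  qed
  have "act_iso k B act (free_act_carrier Y // \<kappa>) (quotient_action free_action \<kappa>)"
    unfolding act_iso_def
  proof (intro conjI ballI allI)
    have "inj_on k B"
    proof (rule inj_onI)
      fix c d assume "c \<in> B" "d \<in> B" "k c = k d"
      moreover obtain w where "fst w \<in> Y" "c = \<beta> w"
        using B_\<beta>[OF \<open>c \<in> B\<close>] by blast
      ultimately have "w \<in> k d"
        unfolding k_def by blast
      with \<open>c = \<beta> w\<close> show "c = d"
        by (simp add: k_def)
    qed
    moreover have "k ` B = free_act_carrier Y // \<kappa>"
    proof
      show "k ` B \<subseteq> free_act_carrier Y // \<kappa>"
      proof
        fix K assume "K \<in> k ` B"
        then obtain c where "c \<in> B" "K = k c" by blast
        moreover from B_\<beta>[OF this(1)] obtain w where "fst w \<in> Y" "c = \<beta> w" by blast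
        ultimately show "K \<in> free_act_carrier Y // \<kappa>"
          by (simp add: k_\<beta> quotientI mem_free_act_carrier)
      qed
      show "free_act_carrier Y // \<kappa> \<subseteq> k ` B"
      proof
        fix K assume "K \<in> free_act_carrier Y // \<kappa>"
        then obtain w where "fst w \<in> Y" "K = \<kappa> `` {w}"
          by (auto simp: mem_free_act_carrier elim: quotientE)
        then show "K \<in> k ` B"
          by (intro image_eqI[of _ _ "\<beta> w"]) (simp_all add: k_\<beta> \<beta>_B)
      qed
    qed
    ultimately show "bij_betw k B (free_act_carrier Y // \<kappa>)"
      by (simp add: bij_betw_def)
  next
    fix c s assume "c \<in> B"
    then obtain w where w: "fst w \<in> Y" "c = \<beta> w"
      using B_\<beta> by blast
    then show "k (act c s) = quotient_action free_action \<kappa> (k c) s"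
      using quotient_action_class[OF \<kappa>c, of w s]
      by (simp add: \<beta>_act k_\<beta> fst_free_action mem_free_act_carrier)
  qed
  moreover have "finite Y"
    by (simp add: Y_def)
  ultimately show ?thesis
    unfolding fp_act_def by (intro conjI exI[of _ Y] exI[of _ \<kappa>] exI[of _ k] act_B \<kappa>)
qed

end

section \<open>From the hypotheses on the monoid to right coherence\<close>

theorem theorem3p2:
  assumes "regular_monoid TYPE('s::monoid_mult)"
    and "\<And>(\<rho> :: ('s \<times> 's) set) a b x y. fg_right_congruence \<rho> \<Longrightarrow>
           fg_right_ideal (saturation (principal_right_ideal a) \<rho>
             \<inter> saturation (principal_right_ideal b) \<rho>) \<and>
           fg_right_ideal (residual (principal_right_ideal a) x
             \<inter> residual (principal_right_ideal b) y)"
  shows "right_coherent TYPE('s) TYPE('b)"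
proof -
  \<comment> \<open>The least right congruence, generated by no pairs, serves as the
    \<open>\<rho>\<close> with which the condition on residuals is instantiated.\<close>
  have "fg_right_congruence (generated_congruence (UNIV :: 's set) (*) {})"
    unfolding fg_right_congruence_iff
    by (rule fg_act_congruence_generated[OF right_act_regular]) simp_all
  note residuals = conjunct2[OF assms(2)[OF this]]
  interpret ideal_coherent "TYPE('s)"
  proof
    show "\<exists>b. a = a * b * a" for a :: 's
      using assms(1) by (simp add: regular_monoid_def)
    show "fg_right_ideal (saturation (principal_right_ideal a) \<rho>)"
      if "fg_right_congruence \<rho>" for a and \<rho> :: "('s \<times> 's) set"
      using conjunct1[OF assms(2)[OF that, of a a]] by simp
    show "fg_right_ideal (principal_right_ideal a \<inter> principal_right_ideal b)" for a b :: 's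
      using residuals[of a 1 b 1] by (simp add: residual_def)
    show "fg_right_ideal (residual (principal_right_ideal a) x)" for a x :: 's
      using residuals[of a x a x] by simp
  qed
  show ?thesis
    unfolding right_coherent_def by (intro allI impI, elim conjE) (rule fp_act_subact)
qed

end
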